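(* Let $m\ge 1$ be an integer, let $u_-=u_0<u_1<\cdots<u_m<u_{m+1}=u_+$ be real numbers, let $a_i>0$, $k_i>0$ for $i=0,\dots,m$ and $d_i\ge 0$ for $i=1,\dots,m$. Then there exists a self-similar solution (in the sense defined in the context) of the one-dimensional multi-phase Stefan problem with Riemann initial data $u(0,x)=u_-$ for $x<0$, $u(0,x)=u_+$ for $x>0$; that is, there exist real numbers $\xi_1<\cdots<\xi_m$ such that the function $u(t,x)=v(x/\sqrt{t})$, with $v$ given by $$v(\xi)=u_i+\frac{u_{i+1}-u_i}{F(\xi_{i+1}/a_i)-F(\xi_i/a_i)}\bigl(F(\xi/a_i)-F(\xi_i/a_i)\bigr),\quad \xi_i<\xi<\xi_{i+1},\ i=0,\ldots,m,$$ where $\xi_0=-\infty$, $\xi_{m+1}=+\infty$, solves this problem.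
   Context: $F(\xi)=\frac{1}{2\sqrt{\pi}}\int_{-\infty}^{\xi}e^{-s^2/4}\,ds$ for $\xi\in\mathbb{R}$, with $F(-\infty)=0$, $F(+\infty)=1$. The Stefan problem is posed in the half-plane $\{(t,x): t>0,\ x\in\mathbb{R}\}$: (i) $u_t=a_i^2u_{xx}$ in the regions where $u_i<u<u_{i+1}$, $i=0,\dots,m$; (ii) on the (unknown) phase transition lines $x=x_i(t)$, where $u=u_i$, $i=1,\dots,m$, the Stefan condition $d_ix_i'(t)+k_iu_x(t,x_i(t)+)-k_{i-1}u_x(t,x_i(t)-)=0$ holds, where $u_x(t,x_i(t)+)$ and $u_x(t,x_i(t)-)$ are the one-sided limits of $u_x$ from the warmer ($u>u_i$) and the colder ($u<u_i$) phase respectively; (iii) the initial condition $u(0,x)=u_-$ for $x<0$, $u(0,x)=u_+$ for $x>0$ (as limits when $t\to0+$). A self-similar solution is a function $u(t,x)=v(x/\sqrt t)$ of the form displayed in the claim (extended continuously by $v(\xi_i)=u_i$), whose phase transition lines are $x_i(t)=\xi_i\sqrt{t}$, satisfying (i)–(iii). For a function of this form, (i) and (iii) hold automatically, and (ii) is equivalent to the system $$\frac{d_i\xi_i}{2}+\frac{k_i(u_{i+1}-u_i)F'(\xi_i/a_i)}{a_i(F(\xi_{i+1}/a_i)-F(\xi_i/a_i))}-\frac{k_{i-1}(u_i-u_{i-1})F'(\xi_i/a_{i-1})}{a_{i-1}(F(\xi_i/a_{i-1})-F(\xi_{i-1}/a_{i-1}))}=0,\quad i=1,\ldots,m.$$ 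*)

theory Defs
  imports "HOL-Analysis.Analysis"
begin

definition F :: "real \<Rightarrow> real" where
  "F \<xi> = 1 / (2 * sqrt pi) * (LBINT s:{..\<xi>}. exp (- (s\<^sup>2) / 4))"

definition F_ext :: "ereal \<Rightarrow> real" where
  "F_ext \<xi> = (if \<xi> = -\<infinity> then 0 else if \<xi> = \<infinity> then 1 else F (real_of_ereal \<xi>))"

text \<open>The breakpoints are \<open>\<xi> 1 < \<dots> < \<xi> m\<close>; this adds the conventions
  \<open>\<xi>\<^sub>0 = -\<infinity>\<close> and \<open>\<xi>\<^sub>m\<^sub>+\<^sub>1 = +\<infinity>\<close>.\<close>

definition breakpoint :: "nat \<Rightarrow> (nat \<Rightarrow> real) \<Rightarrow> nat \<Rightarrow> ereal" where
  "breakpoint m \<xi> i = (if i = 0 then -\<infinity> else if i \<le> m then ereal (\<xi> i) else \<infinity>)"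

text \<open>For increasing breakpoints the two clauses determine \<open>v\<close> uniquely.\<close>

definition self_similar_profile ::
  "nat \<Rightarrow> (nat \<Rightarrow> real) \<Rightarrow> (nat \<Rightarrow> real) \<Rightarrow> (nat \<Rightarrow> real) \<Rightarrow> (real \<Rightarrow> real) \<Rightarrow> bool" where
  "self_similar_profile m u a \<xi> v \<longleftrightarrow>
     (\<forall>i\<in>{0..m}. \<forall>z::real.
        breakpoint m \<xi> i < ereal z \<and> ereal z < breakpoint m \<xi> (i + 1) \<longrightarrow>
        v z = u i + (u (i + 1) - u i)
                / (F_ext (breakpoint m \<xi> (i + 1) / ereal (a i)) - F_ext (breakpoint m \<xi> i / ereal (a i)))
                * (F (z / a i) - F_ext (breakpoint m \<xi> i / ereal (a i)))) \<and>
     (\<forall>i\<in>{1..m}. v (\<xi> i) = u i)"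

text \<open>\<open>w\<^sub>t = a\<^sup>2 w\<^sub>x\<^sub>x\<close> at the point \<open>(t, x)\<close>, including the existence of the derivatives.\<close>

definition heat_equation_at :: "real \<Rightarrow> (real \<Rightarrow> real \<Rightarrow> real) \<Rightarrow> real \<Rightarrow> real \<Rightarrow> bool" where
  "heat_equation_at a w t x \<longleftrightarrow>
     (\<exists>wt wx wxx.
        ((\<lambda>s. w s x) has_real_derivative wt) (at t) \<and>
        (\<forall>\<^sub>F y in nhds x. (w t has_real_derivative wx y) (at y)) \<and>
        (wx has_real_derivative wxx) (at x) \<and>
        wt = a\<^sup>2 * wxx)"

text \<open>Stefan condition at time \<open>t\<close> on the line \<open>X\<close> where \<open>w\<close> attains the value \<open>c\<close>, with
  warmer phase (\<open>w > c\<close>, conductivity \<open>kp\<close>) on the right of the line and colder phase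
  (\<open>w < c\<close>, conductivity \<open>km\<close>) on the left.\<close>

definition stefan_condition_at ::
  "real \<Rightarrow> real \<Rightarrow> real \<Rightarrow> real \<Rightarrow> (real \<Rightarrow> real \<Rightarrow> real) \<Rightarrow> (real \<Rightarrow> real) \<Rightarrow> real \<Rightarrow> bool" where
  "stefan_condition_at c d kp km w X t \<longleftrightarrow>
     (\<forall>\<^sub>F y in at_right (X t). w t y > c \<and> w t differentiable (at y)) \<and>
     (\<forall>\<^sub>F y in at_left (X t). w t y < c \<and> w t differentiable (at y)) \<and>
     (\<exists>X' wxp wxm.
        (X has_real_derivative X') (at t) \<and>
        (deriv (w t) \<longlongrightarrow> wxp) (at_right (X t)) \<and>
        (deriv (w t) \<longlongrightarrow> wxm) (at_left (X t)) \<and>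
        d * X' + kp * wxp - km * wxm = 0)"

text \<open>\<open>w\<close> solves the Stefan problem with phase transition lines \<open>x = X i t\<close>, \<open>i = 1, \<dots>, m\<close>;
  only the values \<open>w t x\<close> with \<open>t > 0\<close> matter.\<close>

definition stefan_solution ::
  "nat \<Rightarrow> real \<Rightarrow> real \<Rightarrow> (nat \<Rightarrow> real) \<Rightarrow> (nat \<Rightarrow> real) \<Rightarrow> (nat \<Rightarrow> real) \<Rightarrow> (nat \<Rightarrow> real) \<Rightarrow>
   (real \<Rightarrow> real \<Rightarrow> real) \<Rightarrow> (nat \<Rightarrow> real \<Rightarrow> real) \<Rightarrow> bool" where
  "stefan_solution m u_minus u_plus u a k d w X \<longleftrightarrow>
     continuous_on ({0<..} \<times> UNIV) (\<lambda>(t, x). w t x) \<and>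
     (\<forall>i\<in>{0..m}. \<forall>t>0. \<forall>x. u i < w t x \<and> w t x < u (i + 1) \<longrightarrow> heat_equation_at (a i) w t x) \<and>
     (\<forall>i\<in>{1..m}. \<forall>t>0.
        (\<forall>x. w t x = u i \<longleftrightarrow> x = X i t) \<and>
        stefan_condition_at (u i) (d i) (k i) (k (i - 1)) w (X i) t) \<and>
     (\<forall>x<0. ((\<lambda>t. w t x) \<longlongrightarrow> u_minus) (at_right 0)) \<and>
     (\<forall>x>0. ((\<lambda>t. w t x) \<longlongrightarrow> u_plus) (at_right 0))"

end

theory Submission
  imports Defs "HOL-Probability.Distributions" "HOL-Probability.Distribution_Functions"
begin

text \<open>
  The Stefan system for \<open>\<xi>\<^sub>1 < \<dots> < \<xi>\<^sub>m\<close> is the critical point equation of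
  \<open>E \<xi> = (\<Sum>i=1..m. d\<^sub>i \<xi>\<^sub>i\<^sup>2 / 4) - (\<Sum>i=0..m. k\<^sub>i (u\<^sub>i\<^sub>+\<^sub>1 - u\<^sub>i) ln (F (\<xi>\<^sub>i\<^sub>+\<^sub>1 / a\<^sub>i) - F (\<xi>\<^sub>i / a\<^sub>i)))\<close>.
  The function \<open>exp (- E)\<close> extends continuously by \<open>0\<close> to configurations with coinciding
  breakpoints, and it is small when \<open>\<xi>\<^sub>1\<close> is near \<open>-\<infinity>\<close> or \<open>\<xi>\<^sub>m\<close> is near \<open>+\<infinity>\<close>, because all factors
  are at most \<open>1\<close> and one of them tends to \<open>0\<close>. So its maximum over weakly ordered configurations
  in a large box is attained at an interior point, which solves the system.
\<close>

section \<open>The distribution function \<open>F\<close> and its density \<open>dF\<close>\<close>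

definition dF :: "real \<Rightarrow> real" where
  "dF x = 1 / (2 * sqrt pi) * exp (- (x\<^sup>2) / 4)"

lemma dF_pos: "0 < dF x"
  by (simp add: dF_def)

lemma dF_eq_normal_density: "dF = normal_density 0 (sqrt 2)"
  by (auto simp: fun_eq_iff dF_def normal_density_def real_sqrt_mult)

lemma integrable_dF: "integrable lborel dF"
  unfolding dF_eq_normal_density by (rule integrable_normal_density) simp

lemma set_integrable_dF: "A \<in> sets borel \<Longrightarrow> set_integrable lborel A dF"
  using integrable_dF integrable_mult_indicator[of A lborel dF] by (simp add: set_integrable_def)

lemma F_eq_set_integral: "F x = (LBINT s:{..x}. dF s)"
  by (simp add: F_def dF_def)

text \<open>Reading \<open>F\<close> as the distribution function of the centred normal law of
  variance 2 makes its limits at both infinities and its bounds instances of general facts on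
  distribution functions.\<close>

lemma F_eq_cdf: "F = cdf (density lborel (normal_density 0 (sqrt 2)))"
proof
  fix x :: real
  have "F x = (\<integral>s. indicator {..x} s * dF s \<partial>lborel)"
    by (simp add: F_eq_set_integral set_lebesgue_integral_def)
  also have "\<dots> = measure (density lborel dF) {..x}"
  proof -
    have "measure (density lborel dF) {..x} = (\<integral>s. indicator {..x} s \<partial>density lborel dF)"
      by simp
    also have "\<dots> = (\<integral>s. dF s *\<^sub>R indicator {..x} s \<partial>lborel)"
      using borel_measurable_integrable[OF integrable_dF]
      by (intro integral_density) (auto simp: dF_pos less_imp_le)
    finally show ?thesis
      by (simp add: mult.commute)
  qed
  finally show "F x = cdf (density lborel (normal_density 0 (sqrt 2))) x"
    by (simp add: cdf_def dF_eq_normal_density)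
qed

lemma real_distribution_normal_density: "real_distribution (density lborel (normal_density 0 (sqrt 2)))"
  by (auto simp: real_distribution_def real_distribution_axioms_def intro!: prob_space_normal_density)

lemma F_at_top: "(F \<longlongrightarrow> 1) at_top"
  using real_distribution.cdf_lim_at_top_prob[OF real_distribution_normal_density] by (simp add: F_eq_cdf)

lemma F_at_bot: "(F \<longlongrightarrow> 0) at_bot"
  using finite_borel_measure.cdf_lim_at_bot[OF real_distribution.finite_borel_measure_M[OF real_distribution_normal_density]]
  by (simp add: F_eq_cdf)

text \<open>The half-line is cut at \<open>x - 1\<close>, strictly to the left of \<open>x\<close>.
  The remaining integral runs over a compact interval with \<open>x\<close> in its interior, so the
  fundamental theorem of calculus gives a two-sided derivative.\<close>

lemma F_has_derivative: "(F has_real_derivative dF x) (at x)"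
proof -
  have split: "F y = F (x - 1) + integral {x - 1..y} dF" if "x - 1 \<le> y" for y
  proof -
    have "F y = (LBINT s:{..<x - 1} \<union> {x - 1..y}. dF s)"
      unfolding F_eq_set_integral using that by (simp add: ivl_disj_un)
    also have "\<dots> = (LBINT s:{..<x - 1}. dF s) + (LBINT s:{x - 1..y}. dF s)"
      by (intro set_integral_Un set_integrable_dF) auto
    \<comment> \<open>The open and the closed half-line differ in a single point, a null
      set.\<close>
    also have "(LBINT s:{..<x - 1}. dF s) = (LBINT s:{..x - 1}. dF s)"
    proof (rule set_integral_null_delta)
      have "sym_diff {..<x - 1} {..x - 1} = {x - 1}"
        by auto
      then show "sym_diff {..<x - 1} {..x - 1} \<in> null_sets lborel"
        by (simp add: finite_imp_null_set_lborel)
    qed (auto simp: integrable_dF)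
    also have "(LBINT s:{x - 1..y}. dF s) = integral {x - 1..y} dF"
      by (intro set_borel_integral_eq_integral set_integrable_dF) auto
    finally show ?thesis
      by (simp add: F_eq_set_integral)
  qed
  have "continuous_on {x - 1..x + 1} dF"
    unfolding dF_def by (intro continuous_intros) auto
  then have "((\<lambda>y. integral {x - 1..y} dF) has_real_derivative dF x) (at x within {x - 1..x + 1})"
    by (rule integral_has_real_derivative) auto
  then have "((\<lambda>y. integral {x - 1..y} dF) has_real_derivative dF x) (at x)"
    by (simp add: at_within_Icc_at)
  then have "((\<lambda>y. F (x - 1) + integral {x - 1..y} dF) has_real_derivative 0 + dF x) (at x)"
    by (intro DERIV_add DERIV_const)
  moreover have "\<forall>\<^sub>F y in nhds x. F y = F (x - 1) + integral {x - 1..y} dF"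
    using eventually_nhds_in_open[of "{x - 1<..}" x] by (auto elim!: eventually_mono intro: split)
  ultimately show ?thesis
    by (subst DERIV_cong_ev[OF refl _ refl]) simp_all
qed

lemma F_has_derivative_chain [derivative_intros]:
  "(g has_real_derivative g') (at x within A) \<Longrightarrow>
   ((\<lambda>x. F (g x)) has_real_derivative dF (g x) * g') (at x within A)"
  using DERIV_chain2[OF F_has_derivative] by blast

lemma dF_has_derivative_chain [derivative_intros]:
  assumes "(g has_real_derivative g') (at x within A)"
  shows "((\<lambda>x. dF (g x)) has_real_derivative (- (g x) / 2 * dF (g x)) * g') (at x within A)"
  unfolding dF_def by (rule derivative_eq_intros assms refl | simp add: field_simps)+

lemma isCont_F: "isCont F x"
  using F_has_derivative DERIV_isCont by blast

lemma continuous_on_F [continuous_intros]: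
  "continuous_on A g \<Longrightarrow> continuous_on A (\<lambda>x. F (g x))"
  using continuous_on_compose2[OF continuous_at_imp_continuous_on[of UNIV F]] isCont_F by auto

lemma isCont_dF: "isCont dF x"
  unfolding dF_def by (auto intro!: continuous_intros)

lemma F_strict_mono: "x < y \<Longrightarrow> F x < F y"
  using DERIV_pos_imp_increasing[of x y F] F_has_derivative dF_pos by blast

lemma F_less_iff [simp]: "F x < F y \<longleftrightarrow> x < y"
  by (metis F_strict_mono linorder_less_linear order_less_asym)

lemma F_le_iff [simp]: "F x \<le> F y \<longleftrightarrow> x \<le> y"
  by (meson F_less_iff linorder_not_le)

lemma F_pos: "0 < F x"
proof -
  have "0 \<le> F (x - 1)"
    by (simp add: F_eq_cdf cdf_def)
  then show ?thesis
    using F_strict_mono[of "x - 1" x] by linarith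
qed

lemma F_less_1: "F x < 1"
proof -
  have "F (x + 1) \<le> 1"
    using real_distribution.cdf_bounded_prob[OF real_distribution_normal_density] by (simp add: F_eq_cdf)
  then show ?thesis
    using F_strict_mono[of x "x + 1"] by linarith
qed

text \<open>Used to show that the first or last factor of \<open>objective\<close> falls below a
  given threshold when the corresponding breakpoint goes to infinity.\<close>

lemma powr_tendsto_0_eventually_less:
  fixes f :: "'a \<Rightarrow> real"
  assumes "(f \<longlongrightarrow> 0) G" "\<And>x. 0 \<le> f x" "0 < p" "0 < c"
  shows "\<forall>\<^sub>F x in G. f x powr p < c"
proof -
  have "((\<lambda>x. f x powr p) \<longlongrightarrow> 0 powr p) G"
    using assms by (intro tendsto_powr') (auto intro: tendsto_const)
  then show ?thesis
    using assms by (auto dest: order_tendstoD(2)[where a = c])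
qed

lemma filterlim_divide_at_top: "0 < (c::real) \<Longrightarrow> LIM x at_top. x / c :> at_top"
  using filterlim_tendsto_pos_mult_at_top[OF tendsto_const[of "inverse c"] _ filterlim_ident]
  by (simp add: divide_inverse mult.commute)

lemma filterlim_divide_at_bot: "0 < (c::real) \<Longrightarrow> LIM x at_bot. x / c :> at_bot"
  using filterlim_tendsto_pos_mult_at_bot[OF tendsto_const[of "inverse c"] _ filterlim_ident]
  by (simp add: divide_inverse mult.commute)

section \<open>The functional whose critical points solve the Stefan system\<close>

locale stefan_data =
  fixes m :: nat and u a k d :: "nat \<Rightarrow> real"
  assumes m_ge_1: "1 \<le> m"
    and u_less: "i \<le> m \<Longrightarrow> u i < u (Suc i)"
    and a_pos: "i \<le> m \<Longrightarrow> 0 < a i"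
    and k_pos: "i \<le> m \<Longrightarrow> 0 < k i"
    and d_nonneg: "1 \<le> i \<Longrightarrow> i \<le> m \<Longrightarrow> 0 \<le> d i"
begin

text \<open>\<open>lower\<close> and \<open>upper\<close> are the values of F(./a_i) at the two ends
  of phase i. The constants 0 and 1 stand for the infinite breakpoints, which keeps the variational
  argument within real numbers.\<close>

definition lower :: "(nat \<Rightarrow> real) \<Rightarrow> nat \<Rightarrow> real" where
  "lower \<xi> i = (if i = 0 then 0 else F (\<xi> i / a i))"

definition upper :: "(nat \<Rightarrow> real) \<Rightarrow> nat \<Rightarrow> real" where
  "upper \<xi> i = (if i = m then 1 else F (\<xi> (Suc i) / a i))"

definition gap :: "(nat \<Rightarrow> real) \<Rightarrow> nat \<Rightarrow> real" where
  "gap \<xi> i = upper \<xi> i - lower \<xi> i"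

definition weight :: "nat \<Rightarrow> real" where
  "weight i = k i * (u (Suc i) - u i)"

lemma weight_pos: "i \<le> m \<Longrightarrow> 0 < weight i"
  using u_less k_pos by (simp add: weight_def)

definition ordered :: "(nat \<Rightarrow> real) \<Rightarrow> bool" where
  "ordered \<xi> \<longleftrightarrow> (\<forall>i. 1 \<le> i \<and> i < m \<longrightarrow> \<xi> i < \<xi> (Suc i))"

lemma orderedD: "ordered \<xi> \<Longrightarrow> 1 \<le> i \<Longrightarrow> i < j \<Longrightarrow> j \<le> m \<Longrightarrow> \<xi> i < \<xi> j"
proof (induction j)
  case (Suc j)
  then have "\<xi> j < \<xi> (Suc j)"
    by (auto simp: ordered_def)
  moreover have "i < j \<Longrightarrow> \<xi> i < \<xi> j"
    using Suc by auto
  ultimately show ?case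
    using Suc.prems by (cases "i = j") auto
qed simp

text \<open>The outer gaps (i = 0 and i = m) are positive for every configuration because
  \<open>F\<close> lies strictly between 0 and 1; an inner gap is positive exactly when its two
  breakpoints are in strict order.\<close>

lemma gap_pos_iff:
  assumes "i \<le> m"
  shows "0 < gap \<xi> i \<longleftrightarrow> (1 \<le> i \<and> i < m \<longrightarrow> \<xi> i < \<xi> (Suc i))"
  using assms a_pos[OF assms] m_ge_1
  by (auto simp: gap_def lower_def upper_def F_pos F_less_1 divide_less_cancel)

lemma gap_nonneg:
  assumes "i \<le> m" "1 \<le> i \<and> i < m \<longrightarrow> \<xi> i \<le> \<xi> (Suc i)"
  shows "0 \<le> gap \<xi> i"
  using assms a_pos[OF assms(1)] m_ge_1
  by (auto simp: gap_def lower_def upper_def F_pos F_less_1 less_imp_le divide_right_mono)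

lemma gap_le_1: "gap \<xi> i \<le> 1"
  using F_pos F_less_1
  by (auto simp: gap_def lower_def upper_def less_imp_le intro: add_mono diff_mono[of _ 1 0, simplified])

text \<open>Written with \<open>powr\<close> instead of an exponential of logarithms: since 0 powr p
  = 0, the same formula also covers coinciding breakpoints and is continuous there.\<close>

definition objective :: "(nat \<Rightarrow> real) \<Rightarrow> real" where
  "objective \<xi> = (\<Prod>i\<le>m. gap \<xi> i powr weight i) * exp (- (\<Sum>i=1..m. d i * (\<xi> i)\<^sup>2 / 4))"

definition log_objective :: "(nat \<Rightarrow> real) \<Rightarrow> real" where
  "log_objective \<xi> = (\<Sum>i\<le>m. weight i * ln (gap \<xi> i)) - (\<Sum>i=1..m. d i * (\<xi> i)\<^sup>2 / 4)"

lemma objective_eq_exp: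
  assumes "\<And>i. i \<le> m \<Longrightarrow> 0 < gap \<xi> i"
  shows "objective \<xi> = exp (log_objective \<xi>)"
proof -
  have "(\<Prod>i\<le>m. gap \<xi> i powr weight i) = (\<Prod>i\<le>m. exp (weight i * ln (gap \<xi> i)))"
    using assms by (intro prod.cong) (auto simp: powr_def less_imp_neq dest: less_imp_neq[OF assms])
  then show ?thesis
    by (simp add: objective_def log_objective_def exp_sum exp_diff exp_minus field_simps)
qed

text \<open>All factors lie in [0, 1], so discarding all but one cannot decrease the product. A
  single small gap therefore makes the whole objective small.\<close>

lemma objective_le:
  assumes "\<And>i. i \<le> m \<Longrightarrow> 0 \<le> gap \<xi> i" "i \<le> m"
  shows "objective \<xi> \<le> gap \<xi> i powr weight i"
proof -
  have "(\<Prod>j\<le>m. gap \<xi> j powr weight j) = gap \<xi> i powr weight i * (\<Prod>j\<in>{..m} - {i}. gap \<xi> j powr weight j)"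
    using assms(2) by (intro prod.remove) auto
  also have "\<dots> \<le> gap \<xi> i powr weight i * 1"
    using assms by (intro mult_left_mono prod_le_1) (auto simp: gap_le_1 weight_pos less_imp_le powr_le1)
  finally have "(\<Prod>j\<le>m. gap \<xi> j powr weight j) \<le> gap \<xi> i powr weight i"
    by simp
  moreover have "exp (- (\<Sum>i=1..m. d i * (\<xi> i)\<^sup>2 / 4)) \<le> 1"
    by (auto intro!: sum_nonneg simp: d_nonneg)
  then have "objective \<xi> \<le> (\<Prod>j\<le>m. gap \<xi> j powr weight j)"
    unfolding objective_def by (intro mult_left_le prod_nonneg) auto
  ultimately show ?thesis
    by simp
qed

section \<open>Existence of an interior maximiser\<close>

definition box :: "real \<Rightarrow> (nat \<Rightarrow> real) set" where
  "box R = {\<xi>. (\<forall>i. \<xi> i \<in> {-R..R}) \<and> (\<forall>i. 1 \<le> i \<and> i < m \<longrightarrow> \<xi> i \<le> \<xi> (Suc i))}"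

text \<open>Configurations are full sequences and every coordinate is confined to [-R, R]. By
  Tychonoff the cube is compact in the product topology, and the weak order conditions cut out a
  closed subset.\<close>

lemma compact_box: "compact (box R)"
proof -
  have "compact (Pi\<^sub>E UNIV (\<lambda>i::nat. {-R..R}))"
    using compactin_PiE[of "\<lambda>_. euclidean" UNIV "\<lambda>i::nat. {-R..R}"]
    by (simp add: euclidean_product_topology)
  moreover have "closed {\<xi> :: nat \<Rightarrow> real. \<forall>i. 1 \<le> i \<and> i < m \<longrightarrow> \<xi> i \<le> \<xi> (Suc i)}"
    by (intro closed_Collect_all closed_Collect_imp closed_Collect_le continuous_on_product_coordinates)
       auto
  moreover have "box R = Pi\<^sub>E UNIV (\<lambda>i::nat. {-R..R}) \<inter> {\<xi>. \<forall>i. 1 \<le> i \<and> i < m \<longrightarrow> \<xi> i \<le> \<xi> (Suc i)}"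
    by (auto simp: box_def PiE_def Pi_def)
  ultimately show ?thesis
    by (simp add: compact_Int_closed)
qed

lemma box_gap_nonneg: "\<xi> \<in> box R \<Longrightarrow> i \<le> m \<Longrightarrow> 0 \<le> gap \<xi> i"
  by (rule gap_nonneg) (auto simp: box_def)

lemma continuous_on_gap: "i \<le> m \<Longrightarrow> continuous_on A (\<lambda>\<xi>. gap \<xi> i)"
proof -
  have F: "continuous_on A (\<lambda>\<xi>. F (\<xi> j / a i))" if "i \<le> m" for j
    using a_pos[OF that]
    by (auto intro!: continuous_intros continuous_on_subset[OF continuous_on_product_coordinates])
  have "continuous_on A (\<lambda>\<xi>. lower \<xi> i)" if "i \<le> m"
    using F[OF that] by (cases "i = 0") (simp_all add: lower_def)
  moreover have "continuous_on A (\<lambda>\<xi>. upper \<xi> i)" if "i \<le> m"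
    using F[OF that] by (cases "i = m") (simp_all add: upper_def)
  ultimately show "i \<le> m \<Longrightarrow> continuous_on A (\<lambda>\<xi>. gap \<xi> i)"
    unfolding gap_def by (intro continuous_on_diff)
qed

lemma continuous_on_objective: "continuous_on (box R) objective"
  unfolding objective_def
  by (intro continuous_intros continuous_on_gap continuous_on_powr' continuous_on_subset[OF continuous_on_product_coordinates])
     (auto simp: box_gap_nonneg weight_pos)

lemma interior_maximum:
  obtains \<xi> R where "\<xi> \<in> box R" "ordered \<xi>"
    "\<forall>i\<in>{1..m}. -R < \<xi> i \<and> \<xi> i < R" "\<forall>\<eta>\<in>box R. objective \<eta> \<le> objective \<xi>"
proof -
  \<comment> \<open>A reference configuration: strictly increasing on 1..m, with every coordinate of
    the sequence in [0, m]. Its positive value \<open>c\<close> is the threshold the maximum has to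
    reach.\<close>
  let ?\<zeta> = "\<lambda>i. min (real i) m"
  define c where "c = objective ?\<zeta>"
  have "0 < gap ?\<zeta> i" if "i \<le> m" for i
    using that by (subst gap_pos_iff) auto
  then have c: "0 < c"
    by (simp add: c_def objective_eq_exp)
  have "((\<lambda>x. F (x / a 0)) \<longlongrightarrow> 0) at_bot"
    by (intro filterlim_compose[OF F_at_bot] filterlim_divide_at_bot) (simp add: a_pos)
  then have "\<forall>\<^sub>F x in at_bot. F (x / a 0) powr weight 0 < c"
    by (rule powr_tendsto_0_eventually_less) (auto simp: c weight_pos F_pos less_imp_le)
  then obtain R1 where R1: "\<And>x. x \<le> R1 \<Longrightarrow> F (x / a 0) powr weight 0 < c"
    by (auto simp: eventually_at_bot_linorder)
  have "((\<lambda>x. 1 - F (x / a m)) \<longlongrightarrow> 1 - 1) at_top"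
    by (intro tendsto_intros filterlim_compose[OF F_at_top] filterlim_divide_at_top) (simp add: a_pos)
  then have "\<forall>\<^sub>F x in at_top. (1 - F (x / a m)) powr weight m < c"
    by (intro powr_tendsto_0_eventually_less) (auto simp: c weight_pos F_less_1 less_imp_le)
  then obtain R2 where R2: "\<And>x. x \<ge> R2 \<Longrightarrow> (1 - F (x / a m)) powr weight m < c"
    by (auto simp: eventually_at_top_linorder)
  \<comment> \<open>\<open>R\<close> is at least m so that the reference configuration lies in the
    box; the other two bounds place both faces of the box where an outer factor is already below
    \<open>c\<close>.\<close>
  define R where "R = Max {-R1, R2, real m}"
  have \<zeta>: "?\<zeta> \<in> box R"
    by (auto simp: box_def R_def le_max_iff_disj min_le_iff_disj)
  obtain \<xi> where \<xi>: "\<xi> \<in> box R" and max: "\<And>\<eta>. \<eta> \<in> box R \<Longrightarrow> objective \<eta> \<le> objective \<xi>"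
    using continuous_attains_sup[OF compact_box _ continuous_on_objective] \<zeta> by (metis empty_iff)
  \<comment> \<open>The maximum is at least \<open>c\<close>, and each single factor bounds it from
    above, so no factor at the maximiser is below \<open>c\<close>. In particular no gap vanishes,
    which forces strict order.\<close>
  have large: "c \<le> gap \<xi> i powr weight i" if "i \<le> m" for i
    using max[OF \<zeta>] objective_le[of \<xi> i, OF box_gap_nonneg[OF \<xi>] that] by (simp add: c_def)
  have "0 < gap \<xi> i" if "i \<le> m" for i
    using large[OF that] c box_gap_nonneg[OF \<xi> that] weight_pos[OF that]
    by (cases "gap \<xi> i = 0") auto
  then have ord: "ordered \<xi>"
    using gap_pos_iff by (auto simp: ordered_def)
  \<comment> \<open>Here gap 0 is F(\<xi> 1 / a 0); for \<xi> 1 at most \<open>R1\<close> its factor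
    would be below \<open>c\<close>.\<close>
  have "R1 < \<xi> 1"
    using R1[of "\<xi> 1"] large[of 0] m_ge_1 by (force simp: gap_def lower_def upper_def)
  then have lo: "- R < \<xi> 1"
    by (auto simp: R_def)
  have "\<xi> m < R2"
    using R2[of "\<xi> m"] large[of m] m_ge_1 by (force simp: gap_def lower_def upper_def)
  then have hi: "\<xi> m < R"
    by (auto simp: R_def)
  have "- R < \<xi> i \<and> \<xi> i < R" if "1 \<le> i" "i \<le> m" for i
    using that lo hi orderedD[OF ord, of 1 i] orderedD[OF ord, of i m]
    by (cases "i = 1"; cases "i = m") auto
  then show ?thesis
    using that[OF \<xi> ord] max by simp
qed

section \<open>The Stefan system as the critical point equation\<close>

definition stefan_system :: "(nat \<Rightarrow> real) \<Rightarrow> bool" where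
  "stefan_system \<xi> \<longleftrightarrow> (\<forall>i. 1 \<le> i \<and> i \<le> m \<longrightarrow>
     d i * \<xi> i / 2 + weight i * dF (\<xi> i / a i) / (a i * gap \<xi> i)
       - weight (i - 1) * dF (\<xi> i / a (i - 1)) / (a (i - 1) * gap \<xi> (i - 1)) = 0)"

text \<open>Moving breakpoint i changes only the two adjacent gaps: it is the left end of phase i
  and the right end of phase i - 1, whence the opposite signs. The result is minus the left-hand
  side of equation i.\<close>

lemma log_objective_derivative:
  assumes i: "1 \<le> i" "i \<le> m" and gap: "\<And>j. j \<le> m \<Longrightarrow> 0 < gap \<xi> j"
  shows "((\<lambda>s. log_objective (\<xi>(i := s))) has_real_derivative
    - (d i * \<xi> i / 2 + weight i * dF (\<xi> i / a i) / (a i * gap \<xi> i)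
       - weight (i - 1) * dF (\<xi> i / a (i - 1)) / (a (i - 1) * gap \<xi> (i - 1)))) (at (\<xi> i))"
proof -
  \<comment> \<open>\<open>g j\<close> is the derivative of gap j in the i-th coordinate. Writing it
    as a sum of two conditionals lets the sum over j split into two sums with one nonzero index
    each.\<close>
  define g where "g j = (if j = i then - dF (\<xi> i / a i) / a i else 0)
      + (if j = i - 1 then dF (\<xi> i / a (i - 1)) / a (i - 1) else 0)" for j
  have dgap: "((\<lambda>s. gap (\<xi>(i := s)) j) has_real_derivative g j) (at (\<xi> i))" if "j \<le> m" for j
  proof -
    consider "j = i" | "j = i - 1" | "j \<noteq> i" "j \<noteq> i - 1"
      by blast
    then show ?thesis
    proof cases
      case 1
      with i a_pos[of i] show ?thesis
        by (cases "i = m") (auto simp: g_def gap_def lower_def upper_def intro!: derivative_eq_intros)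
    next
      case 2
      with i have "i = Suc j" "j < m"
        by auto
      with a_pos[of j] show ?thesis
        by (cases "j = 0") (auto simp: g_def gap_def lower_def upper_def intro!: derivative_eq_intros)
    next
      case 3
      with i have "Suc j \<noteq> i"
        by auto
      with 3 have "gap (\<xi>(i := s)) j = gap \<xi> j" for s
        by (auto simp: gap_def lower_def upper_def)
      with 3 show ?thesis
        by (simp add: g_def)
    qed
  qed
  have "((\<lambda>s. weight j * ln (gap (\<xi>(i := s)) j)) has_real_derivative weight j * (g j / gap \<xi> j)) (at (\<xi> i))"
    if "j \<le> m" for j
    using gap[OF that] by (auto intro!: derivative_eq_intros dgap[OF that])
  then have "((\<lambda>s. \<Sum>j\<le>m. weight j * ln (gap (\<xi>(i := s)) j)) has_real_derivative
      (\<Sum>j\<le>m. weight j * (g j / gap \<xi> j))) (at (\<xi> i))"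
    by (intro DERIV_sum) auto
  moreover have "((\<lambda>s. d j * ((\<xi>(i := s)) j)\<^sup>2 / 4) has_real_derivative (if j = i then d i * \<xi> i / 2 else 0)) (at (\<xi> i))" for j
  proof (cases "j = i")
    case True
    have "((\<lambda>s. d i * s\<^sup>2 / 4) has_real_derivative d i * \<xi> i / 2) (at (\<xi> i))"
      using DERIV_cdivide[OF DERIV_cmult[OF DERIV_pow[of 2 "\<xi> i"]], of "d i" 4] by (simp add: mult.commute)
    with True show ?thesis
      by simp
  qed simp
  then have "((\<lambda>s. \<Sum>j=1..m. d j * ((\<xi>(i := s)) j)\<^sup>2 / 4) has_real_derivative
      (\<Sum>j=1..m. if j = i then d i * \<xi> i / 2 else 0)) (at (\<xi> i))"
    by (intro DERIV_sum)
  ultimately have D: "((\<lambda>s. log_objective (\<xi>(i := s))) has_real_derivative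
      (\<Sum>j\<le>m. weight j * (g j / gap \<xi> j)) - (\<Sum>j=1..m. if j = i then d i * \<xi> i / 2 else 0)) (at (\<xi> i))"
    unfolding log_objective_def by (rule DERIV_diff)
  have sum: "(\<Sum>j\<le>m. weight j * (g j / gap \<xi> j)) =
      (\<Sum>j\<le>m. if j = i then - weight i * dF (\<xi> i / a i) / (a i * gap \<xi> i) else 0)
    + (\<Sum>j\<le>m. if j = i - 1 then weight (i - 1) * dF (\<xi> i / a (i - 1)) / (a (i - 1) * gap \<xi> (i - 1)) else 0)"
    unfolding sum.distrib[symmetric] using i by (intro sum.cong) (auto simp: g_def)
  have "i - 1 \<le> m"
    using i by simp
  then show ?thesis
    using i by (intro DERIV_cong[OF D, unfolded sum]) (simp add: sum)
qed

lemma stefan_system_solvable: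
  obtains \<xi> where "ordered \<xi>" "stefan_system \<xi>"
proof -
  obtain \<xi> R where \<xi>: "\<xi> \<in> box R" and ord: "ordered \<xi>"
    and inside: "\<forall>i\<in>{1..m}. -R < \<xi> i \<and> \<xi> i < R"
    and max: "\<forall>\<eta>\<in>box R. objective \<eta> \<le> objective \<xi>"
    by (rule interior_maximum)
  have gap: "0 < gap \<xi> j" if "j \<le> m" for j
    using ord that by (auto simp: gap_pos_iff ordered_def)
  have "d i * \<xi> i / 2 + weight i * dF (\<xi> i / a i) / (a i * gap \<xi> i)
       - weight (i - 1) * dF (\<xi> i / a (i - 1)) / (a (i - 1) * gap \<xi> (i - 1)) = 0"
    if i: "1 \<le> i" "i \<le> m" for i
  proof -
    \<comment> \<open>The open set of positions for breakpoint i that keep it inside the box and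
      strictly between its neighbours, where these exist.\<close>
    let ?S = "{-R<..<R} \<inter> (if 1 < i then {\<xi> (i - 1)<..} else UNIV) \<inter> (if i < m then {..<\<xi> (Suc i)} else UNIV)"
    have "\<xi> i \<in> ?S"
      using inside i orderedD[OF ord, of "i - 1" i] orderedD[OF ord, of i "Suc i"] by auto
    moreover have "open ?S"
      by (intro open_Int) auto
    ultimately obtain e where e: "0 < e" and ball: "ball (\<xi> i) e \<subseteq> ?S"
      by (metis open_contains_ball)
    \<comment> \<open>After a small move the configuration is still in the box with all gaps
      positive, so \<open>objective\<close> is the exponential of \<open>log_objective\<close> at
      both configurations and maximality passes to the logarithm.\<close>
    have le: "log_objective (\<xi>(i := s)) \<le> log_objective (\<xi>(i := \<xi> i))" if s: "\<bar>\<xi> i - s\<bar> < e" for s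
    proof -
      let ?\<eta> = "\<xi>(i := s)"
      have sS: "s \<in> ?S"
        using ball s by (auto simp: dist_real_def)
      have strict: "?\<eta> j < ?\<eta> (Suc j)" if "1 \<le> j" "j < m" for j
        using that sS orderedD[OF ord, of j "Suc j"] by (auto split: if_splits)
      have "?\<eta> \<in> box R"
        using strict \<xi> sS by (auto simp: box_def less_imp_le)
      then have "objective ?\<eta> \<le> objective \<xi>"
        using max by blast
      moreover have "0 < gap ?\<eta> j" if "j \<le> m" for j
        using gap_pos_iff[OF that] strict by blast
      ultimately show ?thesis
        by (simp add: objective_eq_exp gap)
    qed
    show ?thesis
      using DERIV_local_max[OF log_objective_derivative[OF i gap] e] le by force
  qed
  then show ?thesis
    using that[OF ord] by (simp add: stefan_system_def)
qed

end


section \<open>The profile attached to a solution of the system\<close>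

locale stefan_solved = stefan_data +
  fixes \<xi> :: "nat \<Rightarrow> real"
  assumes ordered: "ordered \<xi>" and system: "stefan_system \<xi>"
begin

lemma \<xi>_less: "1 \<le> i \<Longrightarrow> i < j \<Longrightarrow> j \<le> m \<Longrightarrow> \<xi> i < \<xi> j"
  by (rule orderedD[OF ordered])

lemma \<xi>_le: "1 \<le> i \<Longrightarrow> i \<le> j \<Longrightarrow> j \<le> m \<Longrightarrow> \<xi> i \<le> \<xi> j"
  using \<xi>_less[of i j] by (cases "i = j") auto

lemma gap_pos: "i \<le> m \<Longrightarrow> 0 < gap \<xi> i"
  using ordered by (auto simp: gap_pos_iff ordered_def)

lemma u_strict_mono: "i < j \<Longrightarrow> j \<le> Suc m \<Longrightarrow> u i < u j"
proof (induction j)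
  case (Suc j)
  then show ?case
    using u_less[of j] by (cases "i = j") auto
qed simp

text \<open>The rescaling of F(./a_i) that rises from 0 at the left end of phase i to 1 at its right
  end, as a limit when that end is infinite.\<close>

definition ratio :: "nat \<Rightarrow> real \<Rightarrow> real" where
  "ratio i z = (F (z / a i) - lower \<xi> i) / gap \<xi> i"

lemma ratio_pos: "i \<le> m \<Longrightarrow> (1 \<le> i \<Longrightarrow> \<xi> i < z) \<Longrightarrow> 0 < ratio i z"
  using gap_pos[of i] a_pos[of i]
  by (auto simp: ratio_def lower_def F_pos divide_strict_right_mono)

lemma ratio_less_1: "i \<le> m \<Longrightarrow> (i < m \<Longrightarrow> z < \<xi> (Suc i)) \<Longrightarrow> ratio i z < 1"
  using gap_pos[of i] a_pos[of i]
  by (auto simp: ratio_def gap_def upper_def F_less_1 divide_strict_right_mono)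

lemma ratio_left: "1 \<le> i \<Longrightarrow> ratio i (\<xi> i) = 0"
  by (simp add: ratio_def lower_def)

lemma ratio_right: "i < m \<Longrightarrow> ratio i (\<xi> (Suc i)) = 1"
  using gap_pos[of i] by (simp add: ratio_def gap_def upper_def)

lemma ratio_mono: "i \<le> m \<Longrightarrow> y \<le> z \<Longrightarrow> ratio i y \<le> ratio i z"
  using gap_pos[of i] a_pos[of i] by (auto simp: ratio_def divide_right_mono)

text \<open>Clamping the normalised phase functions to \<open>[0, 1]\<close> gives the piecewise profile as a single
  sum, so that its continuity across the breakpoints is immediate.\<close>

definition profile :: "real \<Rightarrow> real" where
  "profile z = u 0 + (\<Sum>i\<le>m. (u (Suc i) - u i) * max 0 (min 1 (ratio i z)))"

lemma continuous_on_profile: "continuous_on A profile"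
proof -
  have "continuous_on A (ratio i)" if "i \<le> m" for i
    unfolding ratio_def using a_pos[OF that] gap_pos[OF that] by (auto intro!: continuous_intros)
  then show ?thesis
    unfolding profile_def by (auto intro!: continuous_intros)
qed

definition region :: "nat \<Rightarrow> real set" where
  "region i = {z. (1 \<le> i \<longrightarrow> \<xi> i < z) \<and> (i < m \<longrightarrow> z < \<xi> (Suc i))}"

lemma open_region: "open (region i)"
  unfolding region_def by (intro open_Collect_conj open_Collect_imp) (auto intro!: open_Collect_less)

text \<open>On the closed phase i every earlier summand is saturated at its full jump and every
  later one is 0, so the sum telescopes to \<open>u i\<close> plus the current summand. Weak
  inequalities let the formula reach the breakpoints.\<close>

lemma profile_eq:
  assumes i: "i \<le> m" and lo: "1 \<le> i \<Longrightarrow> \<xi> i \<le> z" and hi: "i < m \<Longrightarrow> z \<le> \<xi> (Suc i)"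
  shows "profile z = u i + (u (Suc i) - u i) * ratio i z"
proof -
  have "(u (Suc j) - u j) * max 0 (min 1 (ratio j z)) =
      (if j < i then u (Suc j) - u j else 0) + (if j = i then (u (Suc i) - u i) * ratio i z else 0)"
    if j: "j \<le> m" for j
  proof -
    consider "j < i" | "j = i" | "i < j"
      by linarith
    then show ?thesis
    proof cases
      case 1
      then have "1 \<le> ratio j z"
        using i lo \<xi>_le[of "Suc j" i] ratio_right[of j] ratio_mono[of j "\<xi> (Suc j)" z] by auto
      with 1 show ?thesis
        by simp
    next
      case 2
      have "0 \<le> ratio i z"
        using ratio_left[of i] ratio_mono[of i "\<xi> i" z] ratio_pos[of i z] i lo by (cases "1 \<le> i") auto
      moreover have "ratio i z \<le> 1"
        using ratio_right[of i] ratio_mono[of i z "\<xi> (Suc i)"] ratio_less_1[of i z] i hi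
        by (cases "i < m") auto
      ultimately show ?thesis
        using 2 by simp
    next
      case 3
      then have "ratio j z \<le> 0"
        using j hi \<xi>_le[of "Suc i" j] ratio_left[of j] ratio_mono[of j z "\<xi> j"] by auto
      with 3 show ?thesis
        by simp
    qed
  qed
  then have "profile z = u 0 + (\<Sum>j\<le>m. if j < i then u (Suc j) - u j else 0)
      + (\<Sum>j\<le>m. if j = i then (u (Suc i) - u i) * ratio i z else 0)"
    by (simp add: profile_def sum.distrib)
  also have "(\<Sum>j\<le>m. if j < i then u (Suc j) - u j else 0) = (\<Sum>j | j \<in> {..m} \<and> j < i. u (Suc j) - u j)"
    by (simp only: sum.inter_filter finite_atMost)
  also have "{j. j \<in> {..m} \<and> j < i} = {..<i}"
    using i by auto
  finally show ?thesis
    using i by (simp add: sum_lessThan_telescope)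
qed

lemma profile_at_\<xi>: "1 \<le> i \<Longrightarrow> i \<le> m \<Longrightarrow> profile (\<xi> i) = u i"
  using profile_eq[of i "\<xi> i"] \<xi>_le[of i "Suc i"] ratio_left by auto

lemma profile_region:
  assumes "i \<le> m" "z \<in> region i"
  shows "profile z = u i + (u (Suc i) - u i) * ratio i z" "u i < profile z" "profile z < u (Suc i)"
proof -
  show eq: "profile z = u i + (u (Suc i) - u i) * ratio i z"
    using assms by (intro profile_eq) (auto simp: region_def)
  have "0 < ratio i z" "ratio i z < 1"
    using assms by (auto simp: region_def intro: ratio_pos ratio_less_1)
  then have "0 < (u (Suc i) - u i) * ratio i z" "(u (Suc i) - u i) * ratio i z < (u (Suc i) - u i) * 1"
    using u_less[OF assms(1)] by (auto intro: mult_strict_left_mono)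
  with eq show "u i < profile z" "profile z < u (Suc i)"
    by auto
qed

section \<open>Phases recovered from the values of the profile\<close>

lemma region_cases:
  obtains i where "i \<le> m" "z \<in> region i" | i where "1 \<le> i" "i \<le> m" "z = \<xi> i"
proof -
  \<comment> \<open>Index 0 always belongs to this set. For its largest element i, maximality puts z
    to the left of \<xi> (Suc i) unless i = m, so z is in region i or equals \<xi> i.\<close>
  let ?S = "{j. j \<le> m \<and> (1 \<le> j \<longrightarrow> \<xi> j \<le> z)}"
  have fin: "finite ?S"
    by (rule finite_subset[of _ "{..m}"]) auto
  define i where "i = Max ?S"
  have "0 \<in> ?S"
    by simp
  then have i: "i \<in> ?S"
    unfolding i_def by (metis (no_types, lifting) Max_in empty_iff fin)
  have "Suc i \<le> i" if "Suc i \<in> ?S"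
    using Max_ge[OF fin that] unfolding i_def[symmetric] .
  then have "Suc i \<notin> ?S"
    by (metis not_less_eq_eq order_refl)
  with i have "z \<in> region i \<or> (1 \<le> i \<and> z = \<xi> i)"
    by (force simp: region_def)
  with i show ?thesis
    using that by auto
qed

text \<open>The Stefan problem describes phases by values of the solution, while derivatives are
  computed by location. The phases have disjoint open value ranges, and breakpoints take only the
  separating values, so the value determines the phase.\<close>

lemma region_of_value:
  assumes "i \<le> m" "u i < profile z" "profile z < u (Suc i)"
  shows "z \<in> region i"
proof (rule region_cases[of z])
  fix j assume j: "j \<le> m" "z \<in> region j"
  have "\<not> i < j" "\<not> j < i"
    using profile_region[OF j] assms j(1) u_strict_mono[of "Suc i" j] u_strict_mono[of "Suc j" i]
    by (cases "Suc i = j"; cases "Suc j = i"; force)+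
  with j show ?thesis
    by simp
next
  fix j assume j: "1 \<le> j" "j \<le> m" "z = \<xi> j"
  then show ?thesis
    using assms profile_at_\<xi>[of j] u_strict_mono[of j i] u_strict_mono[of "Suc i" j]
    by (cases j i rule: linorder_cases; cases "Suc i = j") auto
qed

lemma profile_eq_level_iff:
  assumes i: "1 \<le> i" "i \<le> m"
  shows "profile z = u i \<longleftrightarrow> z = \<xi> i"
proof
  assume eq: "profile z = u i"
  show "z = \<xi> i"
  proof (rule region_cases[of z])
    fix j assume j: "j \<le> m" "z \<in> region j"
    then show ?thesis
      using profile_region[OF j] eq i u_strict_mono[of i j] u_strict_mono[of "Suc j" i]
      by (cases j i rule: linorder_cases; cases "Suc j = i") auto
  next
    fix j assume j: "1 \<le> j" "j \<le> m" "z = \<xi> j"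
    then show ?thesis
      using eq i profile_at_\<xi>[of j] u_strict_mono[of i j] u_strict_mono[of j i]
      by (cases j i rule: linorder_cases) auto
  qed
qed (use profile_at_\<xi> i in simp)

section \<open>Heat equation and Stefan condition\<close>

definition slope :: "nat \<Rightarrow> real" where
  "slope i = (u (Suc i) - u i) / (a i * gap \<xi> i)"

lemma profile_has_derivative:
  assumes i: "i \<le> m" and z: "z \<in> region i"
  shows "(profile has_real_derivative slope i * dF (z / a i)) (at z)"
proof -
  have "\<forall>\<^sub>F y in nhds z. profile y = u i + (u (Suc i) - u i) * ratio i y"
    using eventually_nhds_in_open[OF open_region z] by eventually_elim (rule profile_region[OF i])
  moreover have "((\<lambda>y. u i + (u (Suc i) - u i) * ratio i y) has_real_derivative slope i * dF (z / a i)) (at z)"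
    unfolding ratio_def slope_def using a_pos[OF i] gap_pos[OF i]
    by (auto intro!: derivative_eq_intros)
  ultimately show ?thesis
    by (subst DERIV_cong_ev[OF refl _ refl]) simp_all
qed

lemma profile_scaled_has_derivative:
  assumes "i \<le> m" "0 < t" "y / sqrt t \<in> region i"
  shows "((\<lambda>y. profile (y / sqrt t)) has_real_derivative slope i * dF (y / sqrt t / a i) / sqrt t) (at y)"
  using DERIV_chain2[OF profile_has_derivative[OF assms(1,3)] DERIV_cdivide[OF DERIV_ident]]
  by simp

text \<open>Rests on the identity dF'(s) = -(s/2) dF(s): with s = x / (a_i sqrt t), the factor from
  two x-derivatives, multiplied by a_i^2, equals the one from differentiating x / sqrt t in
  t.\<close>

lemma heat_equation:
  assumes i: "i \<le> m" and t: "0 < t" and x: "x / sqrt t \<in> region i"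
  shows "heat_equation_at (a i) (\<lambda>t x. profile (x / sqrt t)) t x"
proof -
  let ?z = "x / sqrt t"
  have "((\<lambda>s. x / sqrt s) has_real_derivative - x / (2 * t * sqrt t)) (at t)"
    using t by (auto intro!: derivative_eq_intros simp: field_simps power2_eq_square)
  then have wt: "((\<lambda>s. profile (x / sqrt s)) has_real_derivative
      slope i * dF (?z / a i) * (- x / (2 * t * sqrt t))) (at t)"
    by (rule DERIV_chain2[where g = "\<lambda>s. x / sqrt s", OF profile_has_derivative[OF i x]])
  have "open ((\<lambda>y. y / sqrt t) -` region i)"
    by (intro open_vimage open_region continuous_intros) (use t in auto)
  then have "\<forall>\<^sub>F y in nhds x. y \<in> (\<lambda>y. y / sqrt t) -` region i"
    by (rule eventually_nhds_in_open) (use x in auto)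
  then have wx: "\<forall>\<^sub>F y in nhds x. ((\<lambda>y. profile (y / sqrt t)) has_real_derivative
      slope i * dF (y / sqrt t / a i) / sqrt t) (at y)"
    by eventually_elim (use profile_scaled_has_derivative[OF i t] in auto)
  have wxx: "((\<lambda>y. slope i * dF (y / sqrt t / a i) / sqrt t) has_real_derivative
      slope i * (- (?z / a i) / 2 * dF (?z / a i) * (1 / sqrt t / a i)) / sqrt t) (at x)"
    by (intro DERIV_cdivide DERIV_cmult dF_has_derivative_chain DERIV_ident)
  have "slope i * dF (?z / a i) * (- x / (2 * t * sqrt t)) =
      (a i)\<^sup>2 * (slope i * (- (?z / a i) / 2 * dF (?z / a i) * (1 / sqrt t / a i)) / sqrt t)"
    using t a_pos[OF i] by (simp add: field_simps power2_eq_square)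
  then show ?thesis
    unfolding heat_equation_at_def by (intro exI conjI) (rule wt wx wxx | assumption)+
qed

text \<open>Stated for an arbitrary filter \<open>G\<close> so that one argument serves both sides
  of a transition line.\<close>

lemma one_sided_flux:
  assumes i: "i \<le> m" and t: "0 < t" and z: "filterlim (\<lambda>y. y / sqrt t) (at \<zeta> within A) G"
    and ev: "\<forall>\<^sub>F z in at \<zeta> within A. z \<in> region i"
  shows "\<forall>\<^sub>F y in G. u i < profile (y / sqrt t) \<and> profile (y / sqrt t) < u (Suc i)
      \<and> (\<lambda>y. profile (y / sqrt t)) differentiable (at y)"
    and "(deriv (\<lambda>y. profile (y / sqrt t)) \<longlongrightarrow> slope i * dF (\<zeta> / a i) / sqrt t) G"
proof -
  have ev: "\<forall>\<^sub>F y in G. y / sqrt t \<in> region i"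
    using ev z by (rule eventually_compose_filterlim)
  then show "\<forall>\<^sub>F y in G. u i < profile (y / sqrt t) \<and> profile (y / sqrt t) < u (Suc i)
      \<and> (\<lambda>y. profile (y / sqrt t)) differentiable (at y)"
    by eventually_elim
       (use profile_region[OF i] profile_scaled_has_derivative[OF i t] real_differentiable_def in blast)
  have "\<forall>\<^sub>F y in G. slope i * dF (y / sqrt t / a i) / sqrt t = deriv (\<lambda>y. profile (y / sqrt t)) y"
    using ev by eventually_elim (use DERIV_imp_deriv[OF profile_scaled_has_derivative[OF i t]] in auto)
  moreover have "((\<lambda>y. y / sqrt t) \<longlongrightarrow> \<zeta>) G"
    using z by (simp add: filterlim_at)
  then have "((\<lambda>y. slope i * dF (y / sqrt t / a i) / sqrt t) \<longlongrightarrow> slope i * dF (\<zeta> / a i) / sqrt t) G"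
    using a_pos[OF i] t by (intro tendsto_intros isCont_tendsto_compose[OF isCont_dF]) auto
  ultimately show "(deriv (\<lambda>y. profile (y / sqrt t)) \<longlongrightarrow> slope i * dF (\<zeta> / a i) / sqrt t) G"
    by (rule Lim_transform_eventually[rotated])
qed

text \<open>The line speed and both fluxes all scale like 1 / sqrt t, so the condition is equation i
  of the system divided by sqrt t.\<close>

lemma stefan_condition:
  assumes i: "1 \<le> i" "i \<le> m" and t: "0 < t"
  shows "stefan_condition_at (u i) (d i) (k i) (k (i - 1))
    (\<lambda>t x. profile (x / sqrt t)) (\<lambda>t. \<xi> i * sqrt t) t"
proof -
  have "((\<lambda>y. y / sqrt t) \<longlongrightarrow> \<xi> i * sqrt t / sqrt t) (at (\<xi> i * sqrt t) within A)" for A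
    using t by (intro tendsto_intros) auto
  then have lim: "((\<lambda>y. y / sqrt t) \<longlongrightarrow> \<xi> i) (at (\<xi> i * sqrt t) within A)" for A
    using t by simp
  \<comment> \<open>Division by the positive number sqrt t preserves order, so each side of the line
    goes to the same side of \<xi> i.\<close>
  have right: "filterlim (\<lambda>y. y / sqrt t) (at_right (\<xi> i)) (at_right (\<xi> i * sqrt t))"
    using t lim by (auto simp: filterlim_at eventually_at_filter pos_less_divide_eq divide_eq_eq)
  have left: "filterlim (\<lambda>y. y / sqrt t) (at_left (\<xi> i)) (at_left (\<xi> i * sqrt t))"
    using t lim by (auto simp: filterlim_at eventually_at_filter pos_divide_less_eq divide_eq_eq)
  \<comment> \<open>For i = m the phase to the right is unbounded, so there is no next breakpoint to
    avoid; likewise for i = 1 on the left below.\<close>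
  have region_right: "\<forall>\<^sub>F z in at_right (\<xi> i). z \<in> region i"
  proof (cases "i < m")
    case True
    then have "\<forall>\<^sub>F z in at_right (\<xi> i). z \<in> {\<xi> i<..<\<xi> (Suc i)}"
      using i \<xi>_less by (intro eventually_at_right_real) auto
    then show ?thesis
      by eventually_elim (auto simp: region_def)
  next
    case False
    then show ?thesis
      using i by (auto simp: region_def eventually_at_filter)
  qed
  have region_left: "\<forall>\<^sub>F z in at_left (\<xi> i). z \<in> region (i - 1)"
  proof (cases "1 < i")
    case True
    then have "\<forall>\<^sub>F z in at_left (\<xi> i). z \<in> {\<xi> (i - 1)<..<\<xi> i}"
      using i \<xi>_less by (intro eventually_at_left_real) auto
    then show ?thesis
      by eventually_elim (use i in \<open>auto simp: region_def\<close>)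
  next
    case False
    then show ?thesis
      using i by (auto simp: region_def eventually_at_filter)
  qed
  note plus = one_sided_flux[OF i(2) t right region_right]
  have i1: "i - 1 \<le> m"
    using i by simp
  note minus = one_sided_flux[OF i1 t left region_left]
  have 1: "\<forall>\<^sub>F y in at_right (\<xi> i * sqrt t). u i < profile (y / sqrt t)
      \<and> (\<lambda>y. profile (y / sqrt t)) differentiable (at y)"
    using plus(1) by eventually_elim auto
  have 2: "\<forall>\<^sub>F y in at_left (\<xi> i * sqrt t). profile (y / sqrt t) < u i
      \<and> (\<lambda>y. profile (y / sqrt t)) differentiable (at y)"
    using minus(1) by eventually_elim (use i in auto)
  have X': "((\<lambda>t. \<xi> i * sqrt t) has_real_derivative \<xi> i / (2 * sqrt t)) (at t)"
    using t by (auto intro!: derivative_eq_intros simp: field_simps)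
  have flux: "k j * (slope j * dF z / sqrt t) = weight j * dF z / (a j * gap \<xi> j) / sqrt t" for j z
    by (simp add: slope_def weight_def)
  have "d i * (\<xi> i / (2 * sqrt t)) + k i * (slope i * dF (\<xi> i / a i) / sqrt t)
      - k (i - 1) * (slope (i - 1) * dF (\<xi> i / a (i - 1)) / sqrt t) =
    (d i * \<xi> i / 2 + weight i * dF (\<xi> i / a i) / (a i * gap \<xi> i)
       - weight (i - 1) * dF (\<xi> i / a (i - 1)) / (a (i - 1) * gap \<xi> (i - 1))) / sqrt t"
    unfolding flux by (simp add: add_divide_distrib diff_divide_distrib)
  also have "\<dots> = 0"
    using system i by (simp add: stefan_system_def)
  finally show ?thesis
    unfolding stefan_condition_at_def
    by (intro conjI exI) (rule 1 2 X' plus(2) minus(2) | assumption)+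
qed

section \<open>Initial data and the complete solution\<close>

lemma profile_at_bot: "(profile \<longlongrightarrow> u 0) at_bot"
proof -
  have "\<forall>\<^sub>F z in at_bot. z < \<xi> 1"
    by (rule eventually_gt_at_bot)
  then have "\<forall>\<^sub>F z in at_bot. u 0 + (u (Suc 0) - u 0) * ratio 0 z = profile z"
    by eventually_elim (simp add: profile_region(1)[of 0] region_def)
  moreover have "((\<lambda>z. ratio 0 z) \<longlongrightarrow> (0 - lower \<xi> 0) / gap \<xi> 0) at_bot"
    unfolding ratio_def using gap_pos[of 0] a_pos[of 0]
    by (intro tendsto_intros filterlim_compose[OF F_at_bot] filterlim_divide_at_bot) auto
  then have "((\<lambda>z. u 0 + (u (Suc 0) - u 0) * ratio 0 z) \<longlongrightarrow> u 0 + (u (Suc 0) - u 0) * 0) at_bot"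
    by (intro tendsto_intros) (simp add: lower_def)
  ultimately show ?thesis
    by (auto elim: Lim_transform_eventually)
qed

lemma profile_at_top: "(profile \<longlongrightarrow> u (Suc m)) at_top"
proof -
  have "\<forall>\<^sub>F z in at_top. \<xi> m < z"
    by (rule eventually_gt_at_top)
  then have "\<forall>\<^sub>F z in at_top. u m + (u (Suc m) - u m) * ratio m z = profile z"
    by eventually_elim (simp add: profile_region(1)[of m] region_def)
  moreover have "((\<lambda>z. ratio m z) \<longlongrightarrow> (1 - lower \<xi> m) / gap \<xi> m) at_top"
    unfolding ratio_def using gap_pos[of m] a_pos[of m]
    by (intro tendsto_intros filterlim_compose[OF F_at_top] filterlim_divide_at_top) auto
  then have "((\<lambda>z. u m + (u (Suc m) - u m) * ratio m z) \<longlongrightarrow> u m + (u (Suc m) - u m) * 1) at_top"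
    using gap_pos[of m] by (intro tendsto_intros) (simp add: gap_def upper_def)
  ultimately show ?thesis
    by (auto elim: Lim_transform_eventually)
qed

text \<open>Links the extended-real convention of the problem to the real quantities used above:
  dividing an infinite breakpoint by a positive number leaves it infinite, where
  \<open>F_ext\<close> is 0 or 1.\<close>

lemma F_ext_breakpoint:
  assumes "i \<le> m"
  shows "F_ext (breakpoint m \<xi> i / ereal (a i)) = lower \<xi> i"
    and "F_ext (breakpoint m \<xi> (i + 1) / ereal (a i)) = upper \<xi> i"
  using a_pos[of 0] a_pos[OF assms] assms by (auto simp: F_ext_def breakpoint_def lower_def upper_def)

lemma self_similar: "self_similar_profile m u a \<xi> profile"
proof -
  have "profile z = u i + (u (i + 1) - u i)
        / (F_ext (breakpoint m \<xi> (i + 1) / ereal (a i)) - F_ext (breakpoint m \<xi> i / ereal (a i)))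
        * (F (z / a i) - F_ext (breakpoint m \<xi> i / ereal (a i)))"
    if "i \<le> m" "breakpoint m \<xi> i < ereal z" "ereal z < breakpoint m \<xi> (i + 1)" for i z
  proof -
    have "z \<in> region i"
      using that by (auto simp: breakpoint_def region_def split: if_splits)
    then show ?thesis
      using profile_region(1)[OF that(1)] unfolding F_ext_breakpoint[OF that(1)]
      by (simp add: ratio_def gap_def)
  qed
  then show ?thesis
    by (auto simp: self_similar_profile_def profile_at_\<xi>)
qed

lemma solution:
  "stefan_solution m (u 0) (u (Suc m)) u a k d (\<lambda>t x. profile (x / sqrt t)) (\<lambda>i t. \<xi> i * sqrt t)"
proof -
  \<comment> \<open>As t decreases to 0, x / sqrt t tends to minus or plus infinity according to the
    sign of x, so the initial values are the limits of the profile.\<close>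
  have inv: "LIM t at_right 0. inverse (sqrt t) :> at_top"
  proof (rule filterlim_compose[OF filterlim_inverse_at_top_right])
    have "(sqrt \<longlongrightarrow> sqrt 0) (at_right 0)"
      by (intro tendsto_intros)
    then show "filterlim sqrt (at_right 0) (at_right 0)"
      by (auto simp: filterlim_at eventually_at_filter)
  qed
  have "continuous_on ({0<..} \<times> UNIV) (\<lambda>p. profile (snd p / sqrt (fst p)))"
    by (intro continuous_on_compose2[OF continuous_on_profile[of UNIV]] continuous_intros) auto
  moreover have "heat_equation_at (a i) (\<lambda>t x. profile (x / sqrt t)) t x"
    if "i \<le> m" "0 < t" "u i < profile (x / sqrt t)" "profile (x / sqrt t) < u (i + 1)" for i t x
    using that region_of_value by (intro heat_equation) auto
  moreover have "profile (x / sqrt t) = u i \<longleftrightarrow> x = \<xi> i * sqrt t" if "1 \<le> i" "i \<le> m" "0 < t" for i t x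
    using that by (simp add: profile_eq_level_iff divide_eq_eq)
  moreover have "((\<lambda>t. profile (x / sqrt t)) \<longlongrightarrow> u 0) (at_right 0)" if "x < 0" for x
    by (rule filterlim_compose[OF profile_at_bot])
       (use filterlim_tendsto_neg_mult_at_bot[OF tendsto_const that inv] in \<open>simp add: divide_inverse\<close>)
  moreover have "((\<lambda>t. profile (x / sqrt t)) \<longlongrightarrow> u (Suc m)) (at_right 0)" if "0 < x" for x
    by (rule filterlim_compose[OF profile_at_top])
       (use filterlim_tendsto_pos_mult_at_top[OF tendsto_const that inv] in \<open>simp add: divide_inverse\<close>)
  ultimately show ?thesis
    unfolding stefan_solution_def by (auto simp: split_beta stefan_condition[simplified])
qed

end

theorem theorem1p2:
  fixes m :: nat and u_minus u_plus :: real and u a k d :: "nat \<Rightarrow> real"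
  assumes "m \<ge> 1"
    and "u 0 = u_minus" and "u (m + 1) = u_plus"
    and "\<And>i. i \<in> {0..m} \<Longrightarrow> u i < u (i + 1)"
    and "\<And>i. i \<in> {0..m} \<Longrightarrow> a i > 0"
    and "\<And>i. i \<in> {0..m} \<Longrightarrow> k i > 0"
    and "\<And>i. i \<in> {1..m} \<Longrightarrow> d i \<ge> 0"
  shows "\<exists>(\<xi> :: nat \<Rightarrow> real) v.
           strict_mono_on {1..m} \<xi> \<and>
           self_similar_profile m u a \<xi> v \<and>
           stefan_solution m u_minus u_plus u a k d
             (\<lambda>t x. v (x / sqrt t)) (\<lambda>i t. \<xi> i * sqrt t)"
proof -
  interpret stefan_data m u a k d
    using assms by unfold_locales auto
  obtain \<xi> where "ordered \<xi>" "stefan_system \<xi>"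
    by (rule stefan_system_solvable)
  then interpret stefan_solved m u a k d \<xi>
    by unfold_locales
  have "strict_mono_on {1..m} \<xi>"
    by (auto simp: strict_mono_on_def intro: \<xi>_less)
  with self_similar solution assms(2,3) show ?thesis
    by auto
qed

end
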